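(* Let $n$ be a positive integer, $\alpha\in\mathbb{R}$, let $B^n$ be the open unit ball in $\mathbb{C}^n$ and $S^{n-1}=\partial B^n$ its boundary sphere. Let $\mu$ be a positive Borel measure on $S^{n-1}$ and let $u(z)=\int_{S^{n-1}}P_\alpha(z,\eta)\,d\mu(\eta)$, $z\in B^n$, be the positive invariant harmonic function in $B^n$ defined by $\mu$ with the Poisson-Szegő kernel $P_\alpha$. Let $\zeta\in S^{n-1}$ and $0\le r'\le r<1$. If $\alpha>-n$, then $$\left(\frac{1-r}{1-r'}\right)^{n+2\alpha}\left(\frac{1+r'}{1+r}\right)^nu(r'\zeta)\le u(r\zeta)\le\left(\frac{1+r}{1+r'}\right)^{n+2\alpha}\left(\frac{1-r'}{1-r}\right)^nu(r'\zeta).$$ If $\alpha<-n$, then $$\left(\frac{1+r}{1+r'}\right)^{n+2\alpha}\left(\frac{1-r'}{1-r}\right)^nu(r'\zeta)\le u(r\zeta)\le\left(\frac{1-r}{1-r'}\right)^{n+2\alpha}\left(\frac{1+r'}{1+r}\right)^nu(r'\zeta).$$ In particular, for $r'=0$, $$\frac{(1-r)^{n+2\alpha}}{(1+r)^n}u(0)\le u(r\zeta)\le\frac{(1+r)^{n+2\alpha}}{(1-r)^n}u(0)\quad\text{if }\alpha>-n,$$ and $$\frac{(1+r)^{n+2\alpha}}{(1-r)^n}u(0)\le u(r\zeta)\le\frac{(1-r)^{n+2\alpha}}{(1+r)^n}u(0)\quad\text{if }\alpha<-n.$$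
   Context: For $z,\zeta\in\mathbb{C}^n$, $z\cdot\overline\zeta=\sum_{i=1}^nz_i\overline{\zeta_i}$. The Poisson-Szegő kernel is $P_\alpha(z,\zeta)=\dfrac{(1-|z|^2)^{n+2\alpha}}{|1-z\cdot\overline\zeta|^{2n+2\alpha}}$ for $z\in B^n$, $\zeta\in S^{n-1}$. It is the kernel for the operator $\Delta_{\alpha,\beta}=4(1-|z|^2)\left\{\sum_{i,j}(\delta_{i,j}-z_i\overline{z_j})\frac{\partial^2}{\partial z_i\partial\overline{z_j}}+\alpha\sum_jz_j\frac{\partial}{\partial z_j}+\beta\sum_j\overline{z_j}\frac{\partial}{\partial\overline{z_j}}-\alpha\beta\right\}$ with $\alpha=\beta$, and invariant harmonic functions are the solutions of $\Delta_{\alpha,\alpha}u=0$. That $u$ is a positive function means $0<u(z)<\infty$ for all $z\in B^n$ (so $\mu$ is finite and nonzero). *)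

theory Defs
  imports "HOL-Analysis.Analysis"
begin

text \<open>The space of \<open>n\<close>-tuples of complex numbers is \<^typ>\<open>complex^'n\<close> with \<open>n = CARD('n)\<close>; its norm is the
  Euclidean one, so the open unit ball is \<^term>\<open>ball (0::complex^'n) 1\<close> and its boundary is
  \<^term>\<open>sphere (0::complex^'n) 1\<close>.\<close>

definition herm_dot :: "complex^'n \<Rightarrow> complex^'n \<Rightarrow> complex" where
  "herm_dot z w = (\<Sum>i\<in>UNIV. z $ i * cnj (w $ i))"

definition poisson_szego_kernel :: "real \<Rightarrow> complex^'n \<Rightarrow> complex^'n \<Rightarrow> real" where
  "poisson_szego_kernel \<alpha> z w =
     (1 - (norm z)\<^sup>2) powr (real CARD('n) + 2 * \<alpha>)
       / (cmod (1 - herm_dot z w)) powr (2 * real CARD('n) + 2 * \<alpha>)"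

definition borel_measure_on_sphere :: "(complex^'n) measure \<Rightarrow> bool" where
  "borel_measure_on_sphere \<mu> \<longleftrightarrow> sets \<mu> = sets (restrict_space borel (sphere 0 1))"

text \<open>The integral of the nonnegative kernel is taken in \<^typ>\<open>ennreal\<close>: the measure is not assumed
  finite, so the value may be infinite.\<close>

definition poisson_szego_integral :: "real \<Rightarrow> (complex^'n) measure \<Rightarrow> complex^'n \<Rightarrow> ennreal" where
  "poisson_szego_integral \<alpha> \<mu> z = (\<integral>\<^sup>+ \<eta>. ennreal (poisson_szego_kernel \<alpha> z \<eta>) \<partial>\<mu>)"

end

theory Submission
  imports Defs
begin

text \<open>The inequalities hold for the kernel itself, for each fixed boundary point \<open>\<eta>\<close>, and pass to
  \<open>u\<close> by integration, because their constants do not depend on \<open>\<eta>\<close>.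

  Put \<open>w = \<zeta> \<cdot> cnj \<eta>\<close>, so that \<open>|w| \<le> 1\<close> by Cauchy--Schwarz. Along the radius through \<open>\<zeta>\<close>,
  \<open>P\<^sub>\<alpha>(r\<zeta>,\<eta>) = ((1 - r\<^sup>2) / (1 - r'\<^sup>2)) powr (n + 2\<alpha>) * (|1 - r'w| / |1 - rw|) powr (2n + 2\<alpha>) * P\<^sub>\<alpha>(r'\<zeta>,\<eta>)\<close>.

  Only the second quotient depends on \<open>\<eta>\<close>. The Moebius map \<open>w \<mapsto> (1 - r'w) / (1 - rw)\<close> sends the
  closed unit disc to a disc that is symmetric about the real axis, with diameter from
  \<open>(1 + r') / (1 + r)\<close> (the image of \<open>w = -1\<close>) to \<open>(1 - r') / (1 - r)\<close> (the image of \<open>w = 1\<close>).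
  These two numbers therefore bound the modulus. Raised to the power \<open>2n + 2\<alpha>\<close> and multiplied by the first factor, they give the two
  constants of the theorem; the sign of \<open>n + \<alpha>\<close> decides which of them is the upper one.\<close>

section \<open>Moduli of Moebius quotients on the unit disc\<close>

text \<open>In terms of \<open>x = Re w\<close> and \<open>s = |w|\<^sup>2\<close>, the difference of the squares of the two sides of
  each of the next two inequalities is
  \<open>r - r'\<close> times an expression that is affine in \<open>s\<close>. In the first lemma that expression decreases
  in \<open>s\<close>, so \<open>s = 1\<close> is the worst case; in the second it increases, so the worst case is the
  smallest possible value \<open>s = x\<^sup>2\<close>.\<close>

lemma cmod_one_minus_le_at_minus_one:
  fixes w :: complex and r r' :: real
  assumes "cmod w \<le> 1" "0 \<le> r'" "r' \<le> r" "r < 1"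
  shows "(1 + r') * cmod (1 - of_real r * w) \<le> (1 + r) * cmod (1 - of_real r' * w)"
proof -
  define x where "x = Re w"
  define s where "s = (cmod w)\<^sup>2"
  have sq: "(cmod (1 - of_real t * w))\<^sup>2 = 1 - 2 * t * x + t\<^sup>2 * s" for t :: real
    unfolding x_def s_def cmod_power2 by (simp add: power2_eq_square algebra_simps)
  have s1: "s \<le> 1"
    unfolding s_def using assms(1) by (simp add: power_le_one)
  have x1: "-1 \<le> x"
    unfolding x_def using assms(1) abs_Re_le_cmod[of w] by linarith
  have rr: "r * r' \<le> 1"
    using mult_le_one[of r r'] assms by simp
  have "s * (r' + r + 2 * r * r') \<le> 1 * (r' + r + 2 * r * r')"
    by (intro mult_right_mono) (use s1 assms in auto)
  moreover have "0 \<le> 2 * (1 - r * r') * (1 + x)"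
    using rr x1 by simp
  ultimately have "0 \<le> (2 + r + r') + 2 * x * (1 - r * r') - s * (r' + r + 2 * r * r')"
    by (simp add: algebra_simps)
  then have "0 \<le> (r - r') * ((2 + r + r') + 2 * x * (1 - r * r') - s * (r' + r + 2 * r * r'))"
    using assms by simp
  also have "\<dots> = (1 + r)\<^sup>2 * (1 - 2 * r' * x + r'\<^sup>2 * s) - (1 + r')\<^sup>2 * (1 - 2 * r * x + r\<^sup>2 * s)"
    by (simp add: power2_eq_square algebra_simps)
  finally have "((1 + r') * cmod (1 - of_real r * w))\<^sup>2 \<le> ((1 + r) * cmod (1 - of_real r' * w))\<^sup>2"
    by (simp add: power_mult_distrib sq)
  then show ?thesis
    by (rule power2_le_imp_le) (use assms in simp)
qed

lemma cmod_one_minus_ge_at_one: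
  fixes w :: complex and r r' :: real
  assumes "cmod w \<le> 1" "0 \<le> r'" "r' \<le> r" "r < 1"
  shows "(1 - r) * cmod (1 - of_real r' * w) \<le> (1 - r') * cmod (1 - of_real r * w)"
proof -
  define x where "x = Re w"
  define s where "s = (cmod w)\<^sup>2"
  have sq: "(cmod (1 - of_real t * w))\<^sup>2 = 1 - 2 * t * x + t\<^sup>2 * s" for t :: real
    unfolding x_def s_def cmod_power2 by (simp add: power2_eq_square algebra_simps)
  have xs: "x\<^sup>2 \<le> s"
    unfolding x_def s_def cmod_power2 by simp
  have x1: "x \<le> 1"
    unfolding x_def using assms(1) abs_Re_le_cmod[of w] by linarith
  have c: "0 \<le> r + r' - 2 * r * r'"
  proof -
    have "0 \<le> r * (1 - r') + r' * (1 - r)"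
      using assms by (intro add_nonneg_nonneg mult_nonneg_nonneg) auto
    then show ?thesis by (simp add: algebra_simps)
  qed
  have "x * (r + r' - 2 * r * r') \<le> 1 * (r + r' - 2 * r * r')"
    by (intro mult_right_mono x1 c)
  moreover have "0 \<le> 2 * ((1 - r) * (1 - r'))"
    using assms by simp
  ultimately have "0 \<le> 2 - r - r' - x * (r + r' - 2 * r * r')"
    by (simp add: algebra_simps)
  then have "0 \<le> (1 - x) * (2 - r - r' - x * (r + r' - 2 * r * r'))"
    using x1 by simp
  also have "\<dots> = 2 - r - r' - 2 * x * (1 - r * r') + x\<^sup>2 * (r + r' - 2 * r * r')"
    by (simp add: power2_eq_square algebra_simps)
  also have "\<dots> \<le> 2 - r - r' - 2 * x * (1 - r * r') + s * (r + r' - 2 * r * r')"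
    using mult_right_mono[OF xs c] by simp
  finally have "0 \<le> (r - r') *
      (2 - r - r' - 2 * x * (1 - r * r') + s * (r + r' - 2 * r * r'))"
    using assms by simp
  also have "\<dots> = (1 - r')\<^sup>2 * (1 - 2 * r * x + r\<^sup>2 * s) - (1 - r)\<^sup>2 * (1 - 2 * r' * x + r'\<^sup>2 * s)"
    by (simp add: power2_eq_square algebra_simps)
  finally have "((1 - r) * cmod (1 - of_real r' * w))\<^sup>2 \<le> ((1 - r') * cmod (1 - of_real r * w))\<^sup>2"
    by (simp add: power_mult_distrib sq)
  then show ?thesis
    by (rule power2_le_imp_le) (use assms in simp)
qed

lemma one_minus_of_real_mult_ne_zero:
  fixes w :: complex and r :: real
  assumes "cmod w \<le> 1" "0 \<le> r" "r < 1"
  shows "1 - of_real r * w \<noteq> 0"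
proof
  assume "1 - of_real r * w = 0"
  then have "cmod (of_real r * w) = 1" by simp
  moreover have "cmod (of_real r * w) \<le> r * 1"
    unfolding norm_mult using assms by (intro mult_mono) auto
  ultimately show False using assms by simp
qed

section \<open>The Poisson--Szego kernel and its integral\<close>

lemma cmod_herm_dot_le: "cmod (herm_dot z w) \<le> norm z * norm w"
proof -
  have "cmod (herm_dot z w) \<le> (\<Sum>i\<in>UNIV. \<bar>cmod (z $ i)\<bar> * \<bar>cmod (w $ i)\<bar>)"
    unfolding herm_dot_def by (rule order_trans[OF norm_sum]) (simp add: norm_mult)
  also have "\<dots> \<le> norm z * norm w"
    unfolding norm_vec_def by (rule L2_set_mult_ineq)
  finally show ?thesis .
qed

lemma herm_dot_scaleR_left: "herm_dot (r *\<^sub>R z) w = of_real r * herm_dot z w"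
  unfolding herm_dot_def sum_distrib_left
  by (rule sum.cong) (auto simp: scaleR_conv_of_real[where 'a=complex] mult.assoc)

lemma poisson_szego_kernel_nonneg: "0 \<le> poisson_szego_kernel \<alpha> z w"
  unfolding poisson_szego_kernel_def by simp

lemma poisson_szego_kernel_measurable:
  assumes "borel_measure_on_sphere \<mu>"
  shows "(\<lambda>w. ennreal (poisson_szego_kernel \<alpha> z w)) \<in> borel_measurable \<mu>"
proof -
  have "continuous_on UNIV (herm_dot z)"
    unfolding herm_dot_def by (intro continuous_intros)
  then have [measurable]: "herm_dot z \<in> borel_measurable borel"
    by (rule borel_measurable_continuous_onI)
  have "(\<lambda>w. ennreal (poisson_szego_kernel \<alpha> z w)) \<in> borel_measurable borel"
    unfolding poisson_szego_kernel_def by measurable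
  then show ?thesis
    using assms unfolding borel_measure_on_sphere_def
    by (simp add: measurable_cong_sets[of \<mu> "restrict_space borel (sphere 0 1)" borel borel]
        measurable_restrict_space1)
qed

text \<open>Both sides carry a factor so that upper and lower bounds are instances of one statement.\<close>

lemma poisson_szego_integral_mono:
  assumes "borel_measure_on_sphere \<mu>" "0 \<le> a" "0 \<le> b"
    and "\<And>\<eta>. \<eta> \<in> sphere 0 1 \<Longrightarrow>
      a * poisson_szego_kernel \<alpha> z \<eta> \<le> b * poisson_szego_kernel \<alpha> z' \<eta>"
  shows "ennreal a * poisson_szego_integral \<alpha> \<mu> z \<le> ennreal b * poisson_szego_integral \<alpha> \<mu> z'"
proof -
  have space: "space \<mu> = sphere 0 1"
    using sets_eq_imp_space_eq[of \<mu> "restrict_space borel (sphere 0 1)"] assms(1)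
    by (simp add: borel_measure_on_sphere_def space_restrict_space)
  have "(\<integral>\<^sup>+ \<eta>. ennreal a * ennreal (poisson_szego_kernel \<alpha> z \<eta>) \<partial>\<mu>)
      \<le> (\<integral>\<^sup>+ \<eta>. ennreal b * ennreal (poisson_szego_kernel \<alpha> z' \<eta>) \<partial>\<mu>)"
    using assms(2-4) space
    by (intro nn_integral_mono)
       (simp add: ennreal_mult[symmetric] poisson_szego_kernel_nonneg ennreal_leI)
  then show ?thesis
    unfolding poisson_szego_integral_def
    by (simp add: nn_integral_cmult poisson_szego_kernel_measurable assms(1))
qed

section \<open>Harnack inequalities along a radius\<close>

lemma poisson_szego_kernel_radial_ratio:
  fixes \<zeta> \<eta> :: "complex^'n"
  assumes "norm \<zeta> = 1" "norm \<eta> = 1" "0 \<le> r'" "r' \<le> r" "r < 1"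
  shows "poisson_szego_kernel \<alpha> (r *\<^sub>R \<zeta>) \<eta> =
    ((1 - r) / (1 - r') * ((1 + r) / (1 + r'))) powr (real CARD('n) + 2 * \<alpha>)
    * (cmod (1 - of_real r' * herm_dot \<zeta> \<eta>) / cmod (1 - of_real r * herm_dot \<zeta> \<eta>))
        powr (2 * real CARD('n) + 2 * \<alpha>)
    * poisson_szego_kernel \<alpha> (r' *\<^sub>R \<zeta>) \<eta>"
proof -
  have w: "cmod (herm_dot \<zeta> \<eta>) \<le> 1"
    using cmod_herm_dot_le[of \<zeta> \<eta>] assms(1,2) by simp
  define d where "d t = cmod (1 - of_real t * herm_dot \<zeta> \<eta>)" for t :: real
  have d: "0 < d r" "0 < d r'"
    using one_minus_of_real_mult_ne_zero[OF w] assms by (auto simp: d_def)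
  have p: "0 < 1 - r\<^sup>2" "0 < 1 - r'\<^sup>2"
    using assms by (auto simp: abs_square_less_1)
  have q: "(1 - r) / (1 - r') * ((1 + r) / (1 + r')) = (1 - r\<^sup>2) / (1 - r'\<^sup>2)"
    by (simp add: power2_eq_square algebra_simps)
  show ?thesis
    using d p unfolding poisson_szego_kernel_def herm_dot_scaleR_left d_def[symmetric] q
    by (simp add: assms(1) powr_divide)
qed

text \<open>For \<open>a = (1 - r) / (1 - r')\<close> and \<open>b = (1 + r) / (1 + r')\<close> this evaluates the quotient of kernels at \<open>w = -1\<close>; with the
  roles of \<open>a\<close> and \<open>b\<close> exchanged it evaluates the quotient at \<open>w = 1\<close>.\<close>

lemma powr_extremal_ratio:
  fixes a b \<alpha> :: real
  assumes "0 < a" "0 < b"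
  shows "(a * b) powr (real n + 2 * \<alpha>) * (1 / b) powr (2 * real n + 2 * \<alpha>)
    = a powr (real n + 2 * \<alpha>) * (1 / b) ^ n"
proof -
  have "(1 / b) powr (2 * real n + 2 * \<alpha>) = (1 / b) powr (real n + 2 * \<alpha>) * (1 / b) powr real n"
    by (simp add: powr_add[symmetric])
  moreover have "(a * b) powr (real n + 2 * \<alpha>) * (1 / b) powr (real n + 2 * \<alpha>)
      = a powr (real n + 2 * \<alpha>)"
    using assms by (simp add: powr_mult[symmetric])
  ultimately show ?thesis
    using assms by (simp add: powr_realpow mult.assoc[symmetric])
qed

text \<open>The two constants are the values of the quotient of kernels at \<open>\<eta> = -\<zeta>\<close> and \<open>\<eta> = \<zeta>\<close>
  respectively. The exponent \<open>2n + 2\<alpha>\<close> of the quotient of denominators makes it increasing or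
  decreasing in that quotient, which orders the two constants.\<close>

lemma poisson_szego_kernel_harnack:
  fixes \<zeta> \<eta> :: "complex^'n" and \<alpha> r r' :: real
  defines "L \<equiv> ((1 - r) / (1 - r')) powr (real CARD('n) + 2 * \<alpha>) * ((1 + r') / (1 + r)) ^ CARD('n)"
    and "U \<equiv> ((1 + r) / (1 + r')) powr (real CARD('n) + 2 * \<alpha>) * ((1 - r') / (1 - r)) ^ CARD('n)"
    and "K \<equiv> \<lambda>t. poisson_szego_kernel \<alpha> (t *\<^sub>R \<zeta>) \<eta>"
  assumes "norm \<zeta> = 1" "norm \<eta> = 1" "0 \<le> r'" "r' \<le> r" "r < 1"
  shows "- real CARD('n) \<le> \<alpha> \<Longrightarrow> L * K r' \<le> K r" "- real CARD('n) \<le> \<alpha> \<Longrightarrow> K r \<le> U * K r'"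
    and "\<alpha> \<le> - real CARD('n) \<Longrightarrow> U * K r' \<le> K r" "\<alpha> \<le> - real CARD('n) \<Longrightarrow> K r \<le> L * K r'"
proof -
  define a b where "a = (1 - r) / (1 - r')" and "b = (1 + r) / (1 + r')"
  define c where "c = 2 * real CARD('n) + 2 * \<alpha>"
  define w where "w = herm_dot \<zeta> \<eta>"
  define q where "q = cmod (1 - of_real r' * w) / cmod (1 - of_real r * w)"
  define A where "A = (a * b) powr (real CARD('n) + 2 * \<alpha>)"
  have w: "cmod w \<le> 1"
    using cmod_herm_dot_le[of \<zeta> \<eta>] assms by (simp add: w_def)
  have pos: "0 < a" "0 < b"
    using assms by (auto simp: a_def b_def)
  have d: "0 < cmod (1 - of_real r * w)"
    using one_minus_of_real_mult_ne_zero[OF w] assms by simp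
  have q_ge: "1 / b \<le> q"
    using cmod_one_minus_le_at_minus_one[OF w assms(6-8)] d assms(6-8)
    by (simp add: q_def b_def divide_simps mult.commute)
  have q_le: "q \<le> 1 / a"
    using cmod_one_minus_ge_at_one[OF w assms(6-8)] d assms(6-8)
    by (simp add: q_def a_def divide_simps mult.commute)
  have q_pos: "0 < q"
    using q_ge pos by (meson less_le_trans zero_less_divide_1_iff)
  have K: "K r = A * q powr c * K r'"
    unfolding K_def A_def q_def c_def w_def a_def b_def
    by (rule poisson_szego_kernel_radial_ratio) (fact assms)+
  have L: "L = A * (1 / b) powr c"
    using powr_extremal_ratio[OF pos, of "CARD('n)" \<alpha>]
    by (simp add: L_def A_def c_def a_def b_def)
  have U: "U = A * (1 / a) powr c"
    using powr_extremal_ratio[OF pos(2,1), of "CARD('n)" \<alpha>]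
    by (simp add: U_def A_def c_def a_def b_def mult.commute)
  have compare: "A * x powr c * K r' \<le> A * y powr c * K r'" if "x powr c \<le> y powr c" for x y
    using that by (intro mult_right_mono mult_left_mono) (auto simp: A_def K_def poisson_szego_kernel_nonneg)
  show "L * K r' \<le> K r" if "- real CARD('n) \<le> \<alpha>"
    unfolding K L using that q_ge pos by (intro compare powr_mono2) (auto simp: c_def)
  show "K r \<le> U * K r'" if "- real CARD('n) \<le> \<alpha>"
    unfolding K U using that q_le q_pos by (intro compare powr_mono2) (auto simp: c_def)
  show "U * K r' \<le> K r" if "\<alpha> \<le> - real CARD('n)"
    unfolding K U using that q_le q_pos by (intro compare powr_mono2') (auto simp: c_def)
  show "K r \<le> L * K r'" if "\<alpha> \<le> - real CARD('n)"
    unfolding K L using that q_ge pos by (intro compare powr_mono2') (auto simp: c_def)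
qed

theorem theorem1p9:
  fixes \<alpha> :: real
    and \<mu> :: "(complex^'n) measure"
    and u :: "complex^'n \<Rightarrow> real"
    and \<zeta> :: "complex^'n"
    and r r' :: real
  defines "n \<equiv> CARD('n)"
  assumes mu: "borel_measure_on_sphere \<mu>"
    and u_eq: "\<And>z. z \<in> ball 0 1 \<Longrightarrow> ennreal (u z) = poisson_szego_integral \<alpha> \<mu> z"
    and u_pos: "\<And>z. z \<in> ball 0 1 \<Longrightarrow> 0 < u z"
    and zeta: "\<zeta> \<in> sphere 0 1"
    and r: "0 \<le> r'" "r' \<le> r" "r < 1"
  shows "(\<alpha> > - real n \<longrightarrow>
            ((1 - r) / (1 - r')) powr (real n + 2 * \<alpha>) * ((1 + r') / (1 + r)) ^ n * u (r' *\<^sub>R \<zeta>)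
              \<le> u (r *\<^sub>R \<zeta>) \<and>
            u (r *\<^sub>R \<zeta>)
              \<le> ((1 + r) / (1 + r')) powr (real n + 2 * \<alpha>) * ((1 - r') / (1 - r)) ^ n * u (r' *\<^sub>R \<zeta>))
       \<and> (\<alpha> < - real n \<longrightarrow>
            ((1 + r) / (1 + r')) powr (real n + 2 * \<alpha>) * ((1 - r') / (1 - r)) ^ n * u (r' *\<^sub>R \<zeta>)
              \<le> u (r *\<^sub>R \<zeta>) \<and>
            u (r *\<^sub>R \<zeta>)
              \<le> ((1 - r) / (1 - r')) powr (real n + 2 * \<alpha>) * ((1 + r') / (1 + r)) ^ n * u (r' *\<^sub>R \<zeta>))
       \<and> (\<alpha> > - real n \<longrightarrow>
            (1 - r) powr (real n + 2 * \<alpha>) / (1 + r) ^ n * u 0 \<le> u (r *\<^sub>R \<zeta>) \<and>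
            u (r *\<^sub>R \<zeta>) \<le> (1 + r) powr (real n + 2 * \<alpha>) / (1 - r) ^ n * u 0)
       \<and> (\<alpha> < - real n \<longrightarrow>
            (1 + r) powr (real n + 2 * \<alpha>) / (1 - r) ^ n * u 0 \<le> u (r *\<^sub>R \<zeta>) \<and>
            u (r *\<^sub>R \<zeta>) \<le> (1 - r) powr (real n + 2 * \<alpha>) / (1 + r) ^ n * u 0)"
proof -
  define L where "L s = ((1 - r) / (1 - s)) powr (real n + 2 * \<alpha>) * ((1 + s) / (1 + r)) ^ n" for s
  define U where "U s = ((1 + r) / (1 + s)) powr (real n + 2 * \<alpha>) * ((1 - s) / (1 - r)) ^ n" for s
  have nz: "norm \<zeta> = 1"
    using zeta by simp
  have u_mono: "a * u z \<le> b * u z'"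
    if "0 \<le> a" "0 \<le> b" "z \<in> ball 0 1" "z' \<in> ball 0 1"
      and "\<And>\<eta>. \<eta> \<in> sphere 0 1 \<Longrightarrow>
        a * poisson_szego_kernel \<alpha> z \<eta> \<le> b * poisson_szego_kernel \<alpha> z' \<eta>" for a b z z'
  proof -
    have "0 \<le> b * u z'"
      using that(2) u_pos[OF that(4)] by simp
    moreover have "ennreal (a * u z) \<le> ennreal (b * u z')"
      using poisson_szego_integral_mono[OF mu that(1,2,5)] u_pos[OF that(3)] u_pos[OF that(4)] that(1,2)
      by (simp add: ennreal_mult u_eq[OF that(3), symmetric] u_eq[OF that(4), symmetric])
    ultimately show ?thesis
      by (simp add: ennreal_le_iff)
  qed
  have harnack:
    "(\<alpha> > - real n \<longrightarrow> L s * u (s *\<^sub>R \<zeta>) \<le> u (r *\<^sub>R \<zeta>) \<and> u (r *\<^sub>R \<zeta>) \<le> U s * u (s *\<^sub>R \<zeta>)) \<and>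
     (\<alpha> < - real n \<longrightarrow> U s * u (s *\<^sub>R \<zeta>) \<le> u (r *\<^sub>R \<zeta>) \<and> u (r *\<^sub>R \<zeta>) \<le> L s * u (s *\<^sub>R \<zeta>))"
    if s: "0 \<le> s" "s \<le> r" for s
  proof -
    have nonneg: "0 \<le> L s" "0 \<le> U s"
      using s r by (auto simp: L_def U_def)
    have ball: "s *\<^sub>R \<zeta> \<in> ball 0 1" "r *\<^sub>R \<zeta> \<in> ball 0 1"
      using s r nz by auto
    note kernel = poisson_szego_kernel_harnack[OF nz _ s r(3), where \<alpha> = \<alpha>,
        folded n_def, folded L_def U_def]
    have lower: "C * u (s *\<^sub>R \<zeta>) \<le> u (r *\<^sub>R \<zeta>)" if "0 \<le> C" and
      "\<And>\<eta>. norm \<eta> = 1 \<Longrightarrow>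
        C * poisson_szego_kernel \<alpha> (s *\<^sub>R \<zeta>) \<eta> \<le> poisson_szego_kernel \<alpha> (r *\<^sub>R \<zeta>) \<eta>" for C
      using u_mono[of C 1, OF that(1) _ ball] that(2) by simp
    have upper: "u (r *\<^sub>R \<zeta>) \<le> C * u (s *\<^sub>R \<zeta>)" if "0 \<le> C" and
      "\<And>\<eta>. norm \<eta> = 1 \<Longrightarrow>
        poisson_szego_kernel \<alpha> (r *\<^sub>R \<zeta>) \<eta> \<le> C * poisson_szego_kernel \<alpha> (s *\<^sub>R \<zeta>) \<eta>" for C
      using u_mono[of 1 C, OF _ that(1) ball(2,1)] that(2) by simp
    show ?thesis
      by (intro conjI impI lower upper nonneg kernel) auto
  qed
  have zero: "L 0 = (1 - r) powr (real n + 2 * \<alpha>) / (1 + r) ^ n"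
    "U 0 = (1 + r) powr (real n + 2 * \<alpha>) / (1 - r) ^ n"
    by (simp_all add: L_def U_def power_divide)
  show ?thesis
    using harnack[OF r(1,2)] harnack[of 0, unfolded zero] r unfolding L_def U_def by simp
qed

end
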